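(* There exists a planar $2$-flow network whose undirected square is not a weak bar $1$-visibility graph.
   Context: A digraph is upward planar if it admits a planar drawing in which every edge is a curve strictly monotonically increasing in the vertical direction. A planar $2$-flow network is a finite upward planar digraph in which every vertex $v$ satisfies $\min\{\mathrm{indeg}(v),\mathrm{outdeg}(v)\}\le 2$. The undirected square of a digraph $G=(V,E)$ is the undirected graph on $V$ with an edge $uv$ whenever $u\ne v$ and there is a directed path of length at most two from $u$ to $v$ or from $v$ to $u$ in $G$. A bar layout is a finite set of pairwise non-intersecting horizontal segments (bars); two bars are $1$-visible if there is an axis-aligned rectangle of non-zero width with bottom side on one bar and top side on the other intersecting at most one other bar. A graph is a weak bar $1$-visibility graph if it is isomorphic to a spanning subgraph of the graph whose vertices are the bars of some bar layout and whose edges are the $1$-visible pairs. *)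

theory Defs
  imports
    "HOL-Analysis.Analysis"
    "Graph_Theory.Pair_Digraph"
    "Graph_Theory.Digraph_Isomorphism"
begin

section \<open>Upward planar digraphs and planar 2-flow networks\<close>

text \<open>A simple path may be closed, so a loop is drawn as a simple closed curve; two
  distinct arcs may only meet at the images of their common end vertices.\<close>

definition planar_drawing ::
  "'a pair_pre_digraph \<Rightarrow> ('a \<Rightarrow> real \<times> real) \<Rightarrow> ('a \<times> 'a \<Rightarrow> real \<Rightarrow> real \<times> real) \<Rightarrow> bool" where
  "planar_drawing G pos \<gamma> \<longleftrightarrow>
     inj_on pos (pverts G) \<and>
     (\<forall>(u, v) \<in> parcs G.
        simple_path (\<gamma> (u, v)) \<and> pathstart (\<gamma> (u, v)) = pos u \<and> pathfinish (\<gamma> (u, v)) = pos v \<and>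
        path_image (\<gamma> (u, v)) \<inter> pos ` pverts G \<subseteq> {pos u, pos v}) \<and>
     (\<forall>(u, v) \<in> parcs G. \<forall>(u', v') \<in> parcs G. (u, v) \<noteq> (u', v') \<longrightarrow>
        path_image (\<gamma> (u, v)) \<inter> path_image (\<gamma> (u', v')) \<subseteq> pos ` ({u, v} \<inter> {u', v'}))"

definition upward_planar :: "'a pair_pre_digraph \<Rightarrow> bool" where
  "upward_planar G \<longleftrightarrow>
     (\<exists>pos \<gamma>. planar_drawing G pos \<gamma> \<and>
        (\<forall>e \<in> parcs G. strict_mono_on {0..1} (\<lambda>t. snd (\<gamma> e t))))"

definition planar_2_flow_network :: "'a pair_pre_digraph \<Rightarrow> bool" where
  "planar_2_flow_network G \<longleftrightarrow>
     pair_fin_digraph G \<and> upward_planar G \<and>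
     (\<forall>v \<in> pverts G. min (in_degree (with_proj G) v) (out_degree (with_proj G) v) \<le> 2)"

section \<open>The undirected square\<close>

text \<open>Undirected graphs are represented as symmetric loop-free digraphs, as in the locale
  \<^locale>\<open>pair_graph\<close>.\<close>

definition undirected_square :: "'a pair_pre_digraph \<Rightarrow> 'a pair_pre_digraph" where
  "undirected_square G =
     \<lparr> pverts = pverts G,
       parcs = {(u, v). u \<in> pverts G \<and> v \<in> pverts G \<and> u \<noteq> v \<and>
         (\<exists>p. length p \<le> 2 \<and>
            (pre_digraph.apath (with_proj G) u p v \<or> pre_digraph.apath (with_proj G) v p u))} \<rparr>"

section \<open>Bar 1-visibility\<close>

type_synonym bar = "(real \<times> real) set"

definition is_bar :: "bar \<Rightarrow> bool" where
  "is_bar b \<longleftrightarrow> (\<exists>l r y. l < r \<and> b = {l..r} \<times> {y})"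

definition bar_layout :: "bar set \<Rightarrow> bool" where
  "bar_layout B \<longleftrightarrow> finite B \<and> (\<forall>b \<in> B. is_bar b) \<and> pairwise disjnt B"

definition one_visible :: "bar set \<Rightarrow> bar \<Rightarrow> bar \<Rightarrow> bool" where
  "one_visible B b b' \<longleftrightarrow>
     (\<exists>x x' y y'. x < x' \<and> y < y' \<and>
        ({x..x'} \<times> {y} \<subseteq> b \<and> {x..x'} \<times> {y'} \<subseteq> b' \<or>
         {x..x'} \<times> {y} \<subseteq> b' \<and> {x..x'} \<times> {y'} \<subseteq> b) \<and>
        card {a \<in> B - {b, b'}. a \<inter> {x..x'} \<times> {y..y'} \<noteq> {}} \<le> 1)"

definition bar_1_visibility_graph :: "bar set \<Rightarrow> bar pair_pre_digraph" where
  "bar_1_visibility_graph B =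
     \<lparr> pverts = B,
       parcs = {(b, b'). b \<in> B \<and> b' \<in> B \<and> b \<noteq> b' \<and> one_visible B b b'} \<rparr>"

definition weak_bar_1_visibility_graph :: "'a pair_pre_digraph \<Rightarrow> bool" where
  "weak_bar_1_visibility_graph G \<longleftrightarrow>
     (\<exists>B H. bar_layout B \<and> pair_graph H \<and>
        spanning (with_proj H) (with_proj (bar_1_visibility_graph B)) \<and>
        digraph_iso (with_proj G) (with_proj H))"

lemma pair_graph_undirected_square:
  assumes "finite (pverts G)"
  shows "pair_graph (undirected_square G)"
proof -
  have "parcs (undirected_square G) \<subseteq> pverts G \<times> pverts G"
    by (auto simp: undirected_square_def)
  then have "finite (parcs (undirected_square G))"
    using assms by (meson finite_SigmaI finite_subset)
  then show ?thesis
    using assms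
    by unfold_locales (auto simp: undirected_square_def symmetric_def intro!: symI)
qed

lemma pair_graph_bar_1_visibility_graph:
  assumes "bar_layout B"
  shows "pair_graph (bar_1_visibility_graph B)"
proof -
  have "parcs (bar_1_visibility_graph B) \<subseteq> B \<times> B"
    by (auto simp: bar_1_visibility_graph_def)
  moreover have "finite B"
    using assms by (simp add: bar_layout_def)
  ultimately have "finite (parcs (bar_1_visibility_graph B))"
    by (meson finite_SigmaI finite_subset)
  moreover have "one_visible B b b' \<longleftrightarrow> one_visible B b' b" for b b'
    by (simp add: one_visible_def insert_commute disj_commute)
  ultimately show ?thesis
    using \<open>finite B\<close>
    by unfold_locales (auto simp: bar_1_visibility_graph_def symmetric_def intro!: symI)
qed

end

theory Submission
  imports Defs
begin

text \<open>A counting argument. Sweep a vertical line from left to right over a layout of $n$ bars. At each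
  abscissa, the 1-visible pairs are those with at most one bar between them. When a bar starts, at
  most four pairs become visible, each with one of the two nearest bars above or below it; when a
  bar ends, at most two do, since one of the two bars must have been adjacent to it and the other
  one step further away on the other side. So a bar 1-visibility graph has at most $6n$ edges.

  In a planar 2-flow network, however, the square can have more edges. Stack vertices of indegree
  two over the edges of the upper boundary of an outerplanar digraph, stack vertices of outdegree
  two below the lower boundary of another one drawn above it, and triangulate the strip between the
  two boundaries upwards. A random search among such networks on 20 vertices found one whose square
  has $123 > 6 \cdot 20$ edges.\<close>

section \<open>Counting pairs in bar 1-visibility graphs\<close>

text \<open>Here \<open>S\<close> stands for the bars met by one vertical line and \<open>y\<close>
  for their heights. Putting the lower bar first lists each unordered pair only once.\<close>

definition near_pairs :: "('a \<Rightarrow> real) \<Rightarrow> 'a set \<Rightarrow> ('a \<times> 'a) set" where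
  "near_pairs y S =
     {(b, c). b \<in> S \<and> c \<in> S \<and> y b < y c \<and> card {a \<in> S. y b < y a \<and> y a < y c} \<le> 1}"

lemma finite_near_pairs:
  assumes "finite S"
  shows "finite (near_pairs y S)"
proof (rule finite_subset)
  show "near_pairs y S \<subseteq> S \<times> S"
    unfolding near_pairs_def by blast
qed (use assms in simp)

text \<open>Ranks increase strictly with \<open>y\<close>: if \<open>u\<close> lies below
  \<open>v\<close>, then \<open>u\<close> itself counts towards the rank of \<open>v\<close> but not
  towards its own.\<close>

lemma rank_inj:
  fixes y :: "'a \<Rightarrow> real"
  assumes "finite X" "inj_on y X"
  shows "inj_on (\<lambda>x. card {a \<in> X. y a < y x}) X"
proof -
  have less: "card {a \<in> X. y a < y u} < card {a \<in> X. y a < y v}"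
    if "u \<in> X" "v \<in> X" "y u < y v" for u v
    using that assms(1) by (intro psubset_card_mono) auto
  show ?thesis
  proof (rule inj_onI)
    fix u v assume uv: "u \<in> X" "v \<in> X" "card {a \<in> X. y a < y u} = card {a \<in> X. y a < y v}"
    then have "\<not> y u < y v" "\<not> y v < y u"
      using less[of u v] less[of v u] by auto
    then show "u = v"
      using assms(2) uv by (auto dest: inj_onD)
  qed
qed

lemma card_near_above:
  fixes y :: "'a \<Rightarrow> real"
  assumes "finite S" "inj_on y S"
  shows "card {b \<in> S. t < y b \<and> card {a \<in> S. t < y a \<and> y a < y b} \<le> 1} \<le> 2"
proof -
  define X where "X = {b \<in> S. t < y b}"
  have eq: "{a \<in> S. t < y a \<and> y a < s} = {a \<in> X. y a < s}" for s
    by (auto simp: X_def)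
  have inj: "inj_on (\<lambda>x. card {a \<in> X. y a < y x}) X"
    using assms by (intro rank_inj) (auto simp: X_def inj_on_def)
  have "{b \<in> S. t < y b \<and> card {a \<in> S. t < y a \<and> y a < y b} \<le> 1} =
      {b \<in> X. card {a \<in> X. y a < y b} \<le> 1}"
    unfolding eq by (auto simp: X_def)
  also have "card \<dots> \<le> card {..1::nat}"
    using inj by (intro card_inj_on_le[of "\<lambda>x. card {a \<in> X. y a < y x}"]) (auto simp: inj_on_def)
  finally show ?thesis
    by simp
qed

lemma card_near_below:
  fixes y :: "'a \<Rightarrow> real"
  assumes "finite S" "inj_on y S"
  shows "card {b \<in> S. y b < t \<and> card {a \<in> S. y b < y a \<and> y a < t} \<le> 1} \<le> 2"
proof -
  \<comment> \<open>Reflecting the heights turns the elements below \<open>t\<close> into those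
    above \<open>- t\<close>.\<close>
  have "inj_on (\<lambda>x. - y x) S"
    using assms(2) by (auto simp: inj_on_def)
  from card_near_above[OF assms(1) this, of "- t"] show ?thesis
    by (simp add: conj_commute)
qed

text \<open>A new element never lowers the number of elements between two old ones, so every new
  near pair contains \<open>c\<close>. Its partner is one of the two nearest elements above or of
  the two nearest below.\<close>

lemma card_near_pairs_insert:
  fixes y :: "'a \<Rightarrow> real"
  assumes "finite S" "inj_on y (insert c S)" "c \<notin> S"
  shows "card (near_pairs y (insert c S) - near_pairs y S) \<le> 4"
proof -
  let ?A = "{b \<in> S. y c < y b \<and> card {a \<in> S. y c < y a \<and> y a < y b} \<le> 1}"
  let ?B = "{b \<in> S. y b < y c \<and> card {a \<in> S. y b < y a \<and> y a < y c} \<le> 1}"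
  have mono: "card {a \<in> S. s < y a \<and> y a < s'} \<le> 1"
    if "card {a \<in> insert c S. s < y a \<and> y a < s'} \<le> 1" for s s'
    using assms(1) by (intro order.trans[OF card_mono that]) auto
  have "near_pairs y (insert c S) - near_pairs y S \<subseteq> Pair c ` ?A \<union> (\<lambda>b. (b, c)) ` ?B"
    unfolding near_pairs_def using mono by auto
  then have "card (near_pairs y (insert c S) - near_pairs y S) \<le>
      card (Pair c ` ?A \<union> (\<lambda>b. (b, c)) ` ?B)"
    using assms(1) by (intro card_mono) auto
  also have "\<dots> \<le> card ?A + card ?B"
    using assms(1) by (intro order.trans[OF card_Un_le] add_mono card_image_le) auto
  also have "\<dots> \<le> 2 + 2"
    using assms by (intro add_mono card_near_above card_near_below) auto
  finally show ?thesis
    by simp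
qed

text \<open>A pair that becomes near when \<open>c\<close> is deleted has \<open>c\<close> and exactly one other element between its
  members, and it is determined by the side of \<open>c\<close> on which that element lies.\<close>

lemma card_near_pairs_delete:
  fixes y :: "'a \<Rightarrow> real"
  assumes "finite S" "inj_on y (insert c S)" "c \<notin> S"
  shows "card (near_pairs y S - near_pairs y (insert c S)) \<le> 2"
proof -
  define below where "below b = card {a \<in> S. y b < y a \<and> y a < y c}" for b
  define above where "above b = card {a \<in> S. y c < y a \<and> y a < y b}" for b
  have inj_above: "b = b'"
    if "b \<in> S" "b' \<in> S" "y c < y b" "y c < y b'" "above b = above b'" for b b'
  proof -
    have "inj_on y {b \<in> S. y c < y b}"
      using assms(2) by (auto simp: inj_on_def)
    from rank_inj[OF _ this] assms(1)
    have "inj_on (\<lambda>x. card {a \<in> {b \<in> S. y c < y b}. y a < y x}) {b \<in> S. y c < y b}"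
      by simp
    moreover have "{a \<in> {b \<in> S. y c < y b}. y a < y x} = {a \<in> S. y c < y a \<and> y a < y x}" for x
      by auto
    ultimately show ?thesis
      using that by (auto simp: above_def inj_on_def)
  qed
  have inj_below: "b = b'"
    if "b \<in> S" "b' \<in> S" "y b < y c" "y b' < y c" "below b = below b'" for b b'
  proof -
    have "inj_on (\<lambda>b. - y b) {b \<in> S. y b < y c}"
      using assms(2) by (auto simp: inj_on_def)
    from rank_inj[OF _ this] assms(1)
    have "inj_on (\<lambda>x. card {a \<in> {b \<in> S. y b < y c}. - y a < - y x}) {b \<in> S. y b < y c}"
      by simp
    moreover have "{a \<in> {b \<in> S. y b < y c}. - y a < - y x} = {a \<in> S. y x < y a \<and> y a < y c}" for x
      by auto
    ultimately show ?thesis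
      using that by (auto simp: below_def inj_on_def)
  qed
  let ?D = "near_pairs y S - near_pairs y (insert c S)"
  have D: "b \<in> S \<and> d \<in> S \<and> y b < y c \<and> y c < y d \<and> below b + above d = 1"
    if "(b, d) \<in> ?D" for b d
  proof -
    have bd: "b \<in> S" "d \<in> S" "y b < y d" "card {a \<in> S. y b < y a \<and> y a < y d} \<le> 1"
      "\<not> card {a \<in> insert c S. y b < y a \<and> y a < y d} \<le> 1"
      using that by (auto simp: near_pairs_def)
    have c: "y b < y c \<and> y c < y d"
    proof (rule ccontr)
      assume "\<not> ?thesis"
      then have "{a \<in> insert c S. y b < y a \<and> y a < y d} = {a \<in> S. y b < y a \<and> y a < y d}"
        by auto
      with bd show False
        by simp
    qed
    then have eq: "{a \<in> insert c S. y b < y a \<and> y a < y d} =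
        insert c {a \<in> S. y b < y a \<and> y a < y d}"
      by auto
    have "card (insert c {a \<in> S. y b < y a \<and> y a < y d}) =
        Suc (card {a \<in> S. y b < y a \<and> y a < y d})"
      using assms(1,3) by (intro card_insert_disjoint) auto
    with bd(4,5) have one: "card {a \<in> S. y b < y a \<and> y a < y d} = 1"
      unfolding eq by linarith
    have "{a \<in> S. y b < y a \<and> y a < y d} =
        {a \<in> S. y b < y a \<and> y a < y c} \<union> {a \<in> S. y c < y a \<and> y a < y d}"
    proof -
      have "y a \<noteq> y c" if "a \<in> S" for a
        using that assms(2,3) by (metis inj_onD insertCI)
      then show ?thesis
        using c by fastforce
    qed
    moreover have "card \<dots> = below b + above d"
      unfolding below_def above_def using assms(1) by (intro card_Un_disjoint) auto
    ultimately show ?thesis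
      using bd c one by simp
  qed
  \<comment> \<open>Since the two counts add up to 1, \<open>below b\<close> fixes
    \<open>above d\<close>; these ranks then fix \<open>b\<close> and \<open>d\<close>. Only the
    values 0 and 1 can occur, hence at most two pairs.\<close>
  have "inj_on (\<lambda>(b, d). below b) ?D"
  proof (rule inj_onI, clarify)
    fix b d b' d' assume "(b, d) \<in> near_pairs y S" "(b, d) \<notin> near_pairs y (insert c S)"
      "(b', d') \<in> near_pairs y S" "(b', d') \<notin> near_pairs y (insert c S)" "below b = below b'"
    with D[of b d] D[of b' d'] show "b = b' \<and> d = d'"
      using inj_below[of b b'] inj_above[of d d'] by simp
  qed
  then have "card ?D \<le> card {..1::nat}"
    using D by (intro card_inj_on_le[of "\<lambda>(b, d). below b"]) force+
  then show ?thesis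
    by simp
qed

section \<open>Change of the near pairs between two sets of active bars\<close>

lemma card_Diff_triangle:
  assumes "finite A" "finite B"
  shows "card (A - C) \<le> card (A - B) + card (B - C)"
proof -
  have "card (A - C) \<le> card ((A - B) \<union> (B - C))"
    using assms by (intro card_mono) auto
  also have "\<dots> \<le> card (A - B) + card (B - C)"
    by (rule card_Un_le)
  finally show ?thesis .
qed

text \<open>Adding the elements of \<open>D\<close> one at a time sums the costs of the single
  insertions. The second bound, read backwards, is the number of pairs gained when \<open>D\<close>
  is deleted.\<close>

lemma card_near_pairs_Un:
  fixes y :: "'a \<Rightarrow> real"
  assumes "finite D" "finite S" "inj_on y (S \<union> D)" "S \<inter> D = {}"
  shows "card (near_pairs y (S \<union> D) - near_pairs y S) \<le> 4 * card D \<and>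
    card (near_pairs y S - near_pairs y (S \<union> D)) \<le> 2 * card D"
  using assms
proof (induction D rule: finite_induct)
  case (insert c D)
  let ?T = "S \<union> D"
  have fin: "finite ?T"
    using insert.hyps insert.prems by simp
  have inj: "inj_on y (insert c ?T)" "c \<notin> ?T"
    using insert.hyps insert.prems by auto
  then have IH: "card (near_pairs y ?T - near_pairs y S) \<le> 4 * card D"
    "card (near_pairs y S - near_pairs y ?T) \<le> 2 * card D"
    using insert by (auto simp: inj_on_def)
  have "card (near_pairs y (insert c ?T) - near_pairs y S) \<le> 4 + 4 * card D"
    using card_Diff_triangle[of "near_pairs y (insert c ?T)" "near_pairs y ?T" "near_pairs y S"]
      card_near_pairs_insert[OF fin inj] IH(1) fin
    by (meson add_mono finite_insert finite_near_pairs le_trans)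
  moreover have "card (near_pairs y S - near_pairs y (insert c ?T)) \<le> 2 * card D + 2"
    using card_Diff_triangle[of "near_pairs y S" "near_pairs y ?T" "near_pairs y (insert c ?T)"]
      card_near_pairs_delete[OF fin inj] IH(2) fin insert.prems(1)
    by (meson add_mono finite_near_pairs le_trans)
  ultimately show ?case
    using insert.hyps by simp
qed simp

text \<open>First delete \<open>S - S'\<close>, then add \<open>S' - S\<close>. The detour goes
  through the intersection because \<open>y\<close> may fail to be injective on the union: bars
  active at different abscissae may have equal heights.\<close>

lemma card_near_pairs_change:
  fixes y :: "'a \<Rightarrow> real"
  assumes "finite S" "finite S'" "inj_on y S" "inj_on y S'"
  shows "card (near_pairs y S' - near_pairs y S) \<le> 4 * card (S' - S) + 2 * card (S - S')"
proof -
  let ?I = "S \<inter> S'"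
  have "card (near_pairs y (?I \<union> (S' - S)) - near_pairs y ?I) \<le> 4 * card (S' - S)"
    using assms by (intro conjunct1[OF card_near_pairs_Un]) (auto simp: inj_on_def)
  moreover have "card (near_pairs y ?I - near_pairs y (?I \<union> (S - S'))) \<le> 2 * card (S - S')"
    using assms by (intro conjunct2[OF card_near_pairs_Un]) (auto simp: inj_on_def)
  moreover have "?I \<union> (S' - S) = S'" "?I \<union> (S - S') = S"
    by auto
  ultimately show ?thesis
    using card_Diff_triangle[of "near_pairs y S'" "near_pairs y ?I" "near_pairs y S"] assms
    by (simp add: finite_near_pairs)
qed

text \<open>The half-open intervals make the set of active bars constant from one end point up to the next, so
  that testing finitely many abscissae suffices.\<close>

lemma card_sweep_pairs:
  fixes y l r :: "'a \<Rightarrow> real"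
  defines "S \<equiv> \<lambda>B t. {b \<in> B. l b \<le> t \<and> t < r b}"
  assumes "finite B" "finite T" and inj: "\<And>t. inj_on y (S B t)"
  shows "card (\<Union>t\<in>T. near_pairs y (S B t)) \<le> 6 * card B"
proof -
  have finS: "finite (S B t)" for t
    using assms(2) by (simp add: S_def)
  \<comment> \<open>Invariant of the sweep: four pairs are charged to each bar begun so far and two
    to each bar ended. The guard is there because \<open>Max {}\<close> is unspecified.\<close>
  have "T \<noteq> {} \<longrightarrow> card (\<Union>t\<in>T. near_pairs y (S B t)) \<le>
      4 * card {b \<in> B. l b \<le> Max T} + 2 * card {b \<in> B. r b \<le> Max T}"
    using \<open>finite T\<close>
  proof (induction T rule: finite_linorder_max_induct)
    case (insert t T)
    have max: "Max (insert t T) = t"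
      using insert.hyps by (intro Max_eqI) (auto intro: less_imp_le)
    show ?case
    proof (cases "T = {}")
      case True
      \<comment> \<open>At the first abscissa, the active bars are compared with the empty
        set.\<close>
      have "card (near_pairs y (S B t) - near_pairs y {}) \<le> 4 * card (S B t - {}) + 2 * card ({} - S B t)"
        using finS inj by (intro card_near_pairs_change) auto
      also have "\<dots> \<le> 4 * card {b \<in> B. l b \<le> t}"
        using assms(2) by (simp add: S_def) (rule card_mono; auto)
      finally show ?thesis
        using True by (simp add: near_pairs_def)
    next
      case False
      define m where "m = Max T"
      have m: "m \<in> T" "m < t"
        using False insert.hyps by (auto simp: m_def)
      let ?U = "\<Union>t\<in>T. near_pairs y (S B t)"
      let ?N = "near_pairs y (S B t) - near_pairs y (S B m)"
      \<comment> \<open>A bar active at \<open>t\<close> but not at \<open>m\<close> starts in the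
        interval from \<open>m\<close> (excluded) to \<open>t\<close>, so it has not been charged
        for its start before. Likewise below for the ends of bars that cease to be active.\<close>
      have "card (S B t - S B m) + card {b \<in> B. l b \<le> m} \<le> card {b \<in> B. l b \<le> t}"
        using assms(2) m
        by (subst card_Un_disjoint[symmetric]) (auto simp: S_def intro!: card_mono)
      moreover have "card (S B m - S B t) + card {b \<in> B. r b \<le> m} \<le> card {b \<in> B. r b \<le> t}"
        using assms(2) m
        by (subst card_Un_disjoint[symmetric]) (auto simp: S_def intro!: card_mono)
      moreover have "card ?N \<le> 4 * card (S B t - S B m) + 2 * card (S B m - S B t)"
        using finS inj by (intro card_near_pairs_change)
      moreover have "card (\<Union>t\<in>insert t T. near_pairs y (S B t)) \<le> card ?U + card ?N"
      proof -
        have "(\<Union>t\<in>insert t T. near_pairs y (S B t)) = ?U \<union> ?N"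
          using m by auto
        then show ?thesis
          by (simp add: card_Un_le)
      qed
      moreover have "card ?U \<le> 4 * card {b \<in> B. l b \<le> m} + 2 * card {b \<in> B. r b \<le> m}"
        using insert.IH False by (simp add: m_def)
      ultimately show ?thesis
        unfolding max by linarith
    qed
  qed simp
  moreover have "card {b \<in> B. l b \<le> Max T} \<le> card B" "card {b \<in> B. r b \<le> Max T} \<le> card B"
    using assms(2) by (auto intro: card_mono)
  ultimately show ?thesis
    by (cases "T = {}") auto
qed

section \<open>From sweeps to bar layouts\<close>

text \<open>Every 1-visible pair is near at the abscissa of some end point, so the sweep bound
  applies. It doubles from 6 to 12 because each edge is represented by two arcs.\<close>

lemma card_arcs_bar_1_visibility_graph:
  assumes "bar_layout B"
  shows "card (parcs (bar_1_visibility_graph B)) \<le> 12 * card B"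
proof -
  have fin: "finite B" and disj: "pairwise disjnt B"
    using assms by (auto simp: bar_layout_def)
  have "\<forall>b\<in>B. \<exists>p :: real \<times> real \<times> real. fst p < fst (snd p) \<and>
      b = {fst p..fst (snd p)} \<times> {snd (snd p)}"
    using assms by (auto simp: bar_layout_def is_bar_def)
  then obtain p :: "bar \<Rightarrow> real \<times> real \<times> real" where
    p: "\<And>b. b \<in> B \<Longrightarrow> fst (p b) < fst (snd (p b)) \<and>
      b = {fst (p b)..fst (snd (p b))} \<times> {snd (snd (p b))}"
    by metis
  define l where "l b = fst (p b)" for b
  define r where "r b = fst (snd (p b))" for b
  define y where "y b = snd (snd (p b))" for b
  have bar: "z \<in> b \<longleftrightarrow> l b \<le> fst z \<and> fst z \<le> r b \<and> snd z = y b" if "b \<in> B" for b z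
    using p[OF that] unfolding l_def r_def y_def by (cases z) (metis atLeastAtMost_iff fst_conv
        mem_Times_iff singleton_iff snd_conv)
  define S where "S t = {b \<in> B. l b \<le> t \<and> t < r b}" for t
  define T where "T = l ` B \<union> r ` B"
  define P where "P = (\<Union>t\<in>T. near_pairs y (S t))"
  have inj: "inj_on y (S t)" for t
  proof (rule inj_onI)
    fix a b assume ab: "a \<in> S t" "b \<in> S t" "y a = y b"
    then have "(t, y a) \<in> a \<inter> b"
      by (auto simp: S_def bar)
    then show "a = b"
      using disj ab by (auto simp: pairwise_def disjnt_def S_def)
  qed
  have finP: "finite P"
    using fin by (auto simp: P_def T_def S_def intro!: finite_near_pairs)
  have cardP: "card P \<le> 6 * card B"
    unfolding P_def S_def
    using fin inj by (intro card_sweep_pairs) (auto simp: T_def S_def)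
  have visible: "(b, c) \<in> P"
    if bc: "b \<in> B" "c \<in> B" "b \<noteq> c" and x: "x < x'" and h: "h < h'"
      and sub: "{x..x'} \<times> {h} \<subseteq> b" "{x..x'} \<times> {h'} \<subseteq> c"
      and card: "card {a \<in> B - {b, c}. a \<inter> {x..x'} \<times> {h..h'} \<noteq> {}} \<le> 1" for b c x x' h h'
  proof -
    have "(x, h) \<in> b" "(x', h) \<in> b" "(x, h') \<in> c" "(x', h') \<in> c"
      using sub x by auto
    then have b: "l b \<le> x" "x' \<le> r b" "y b = h" and c: "l c \<le> x" "x' \<le> r c" "y c = h'"
      using bc by (auto simp: bar)
    \<comment> \<open>The last end point not to the right of the rectangle's left side. No bar
      starts or ends after \<open>t\<close> and up to \<open>x\<close>, so the same bars are active
      at both.\<close>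
    define t where "t = Max {s \<in> T. s \<le> x}"
    have finT: "finite {s \<in> T. s \<le> x}"
      using fin by (simp add: T_def)
    have lb: "l b \<in> {s \<in> T. s \<le> x}"
      using b bc by (simp add: T_def)
    then have t: "t \<in> T" "t \<le> x"
      using Max_in[OF finT] by (auto simp: t_def)
    have le_t: "s \<le> t" if "s \<in> T" "s \<le> x" for s
      using that Max_ge[OF finT] by (simp add: t_def)
    have St: "S t = {b \<in> B. l b \<le> x \<and> x < r b}"
    proof -
      have "l a \<le> t \<longleftrightarrow> l a \<le> x" "t < r a \<longleftrightarrow> x < r a" if "a \<in> B" for a
      proof -
        have "l a \<in> T" "r a \<in> T"
          using that by (simp_all add: T_def)
        with \<open>t \<le> x\<close> le_t[of "l a"] le_t[of "r a"]
        show "l a \<le> t \<longleftrightarrow> l a \<le> x" "t < r a \<longleftrightarrow> x < r a"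
          by linarith+
      qed
      then show ?thesis
        unfolding S_def by blast
    qed
    have "{a \<in> S t. y b < y a \<and> y a < y c} \<subseteq> {a \<in> B - {b, c}. a \<inter> {x..x'} \<times> {h..h'} \<noteq> {}}"
    proof
      fix a assume a: "a \<in> {a \<in> S t. y b < y a \<and> y a < y c}"
      then have "(x, y a) \<in> a \<inter> {x..x'} \<times> {h..h'}"
        using x b c by (auto simp: St bar)
      with a show "a \<in> {a \<in> B - {b, c}. a \<inter> {x..x'} \<times> {h..h'} \<noteq> {}}"
        by (auto simp: St)
    qed
    then have "card {a \<in> S t. y b < y a \<and> y a < y c} \<le> 1"
      using fin by (intro order.trans[OF card_mono card]) auto
    \<comment> \<open>The non-zero width matters: \<open>x < x'\<close> puts \<open>x\<close>
      strictly left of both right ends, so \<open>b\<close> and \<open>c\<close> are active in the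
      half-open sense.\<close>
    then have "(b, c) \<in> near_pairs y (S t)"
      using b c bc x h by (auto simp: near_pairs_def St)
    then show ?thesis
      using t by (auto simp: P_def)
  qed
  have "parcs (bar_1_visibility_graph B) \<subseteq> P \<union> P\<inverse>"
  proof
    fix e assume arc: "e \<in> parcs (bar_1_visibility_graph B)"
    obtain b c where bc: "e = (b, c)"
      by (rule prod.exhaust)
    have e: "b \<in> B" "c \<in> B" "b \<noteq> c" "one_visible B b c"
      using arc unfolding bc by (simp_all add: bar_1_visibility_graph_def)
    obtain x x' h h' where vis: "x < x'" "h < h'"
      "{x..x'} \<times> {h} \<subseteq> b \<and> {x..x'} \<times> {h'} \<subseteq> c \<or> {x..x'} \<times> {h} \<subseteq> c \<and> {x..x'} \<times> {h'} \<subseteq> b"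
      "card {a \<in> B - {b, c}. a \<inter> {x..x'} \<times> {h..h'} \<noteq> {}} \<le> 1"
      using e(4) unfolding one_visible_def by blast
    from vis(3) have "(b, c) \<in> P \<or> (c, b) \<in> P"
    proof (elim disjE conjE)
      assume "{x..x'} \<times> {h} \<subseteq> b" "{x..x'} \<times> {h'} \<subseteq> c"
      then show ?thesis
        using visible[OF e(1-3) vis(1,2)] vis(4) by simp
    next
      assume "{x..x'} \<times> {h} \<subseteq> c" "{x..x'} \<times> {h'} \<subseteq> b"
      then show ?thesis
        using visible[OF e(2,1) e(3)[symmetric] vis(1,2)] vis(4) by (simp add: insert_commute)
    qed
    then show "e \<in> P \<union> P\<inverse>"
      unfolding bc by simp
  qed
  then have "card (parcs (bar_1_visibility_graph B)) \<le> card (P \<union> P\<inverse>)"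
    using finP by (intro card_mono) auto
  also have "\<dots> \<le> card P + card P"
    using card_Un_le[of P "P\<inverse>"] by simp
  finally show ?thesis
    using cardP by simp
qed

text \<open>An isomorphism preserves both counts, and a spanning subgraph keeps all vertices while
  it can only lose arcs.\<close>

lemma weak_bar_1_visibility_graph_card:
  assumes "weak_bar_1_visibility_graph G"
  shows "card (parcs G) \<le> 12 * card (pverts G)"
proof -
  obtain B H where B: "bar_layout B"
    and sp: "spanning (with_proj H) (with_proj (bar_1_visibility_graph B))"
    and "digraph_iso (with_proj G) (with_proj H)"
    using assms by (auto simp: weak_bar_1_visibility_graph_def)
  then obtain f where f: "pre_digraph.digraph_isomorphism (with_proj G) f"
    and H: "with_proj H = app_iso f (with_proj G)"
    by (auto simp: digraph_iso_def)
  have inj: "inj_on (iso_verts f) (pverts G)" "inj_on (iso_arcs f) (parcs G)"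
    using f by (auto simp: pre_digraph.digraph_isomorphism_def)
  have "pverts H = iso_verts f ` pverts G" "parcs H = iso_arcs f ` parcs G"
    using arg_cong[OF H, of verts] arg_cong[OF H, of arcs] by simp_all
  then have "card (parcs G) = card (parcs H)" "card (pverts G) = card (pverts H)"
    using inj by (simp_all add: card_image)
  moreover have "pverts H = B" "parcs H \<subseteq> parcs (bar_1_visibility_graph B)"
    using sp by (auto simp: spanning_def subgraph_def bar_1_visibility_graph_def)
  moreover have "finite (parcs (bar_1_visibility_graph B))"
    using pair_graph_bar_1_visibility_graph[OF B]
    by (simp add: pair_graph_def pair_digraph_def pair_fin_digraph.pair_finite_arcs)
  ultimately show ?thesis
    using card_arcs_bar_1_visibility_graph[OF B] by (metis card_mono le_trans)
qed

section \<open>Straight-line upward drawings on the integer grid\<close>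

text \<open>Twice the signed area of the triangle \<open>a b c\<close>; its sign tells the side of
  the line through \<open>a\<close> and \<open>b\<close> on which \<open>c\<close> lies. The general
  ring allows evaluation over \<open>int\<close> and geometry over \<open>real\<close>.\<close>

definition cross :: "'b::comm_ring \<times> 'b \<Rightarrow> 'b \<times> 'b \<Rightarrow> 'b \<times> 'b \<Rightarrow> 'b" where
  "cross a b c = (fst b - fst a) * (snd c - snd a) - (snd b - snd a) * (fst c - fst a)"

lemma cross_affine:
  fixes a b c d :: "real \<times> real"
  shows "cross a b ((1 - t) *\<^sub>R c + t *\<^sub>R d) = (1 - t) * cross a b c + t * cross a b d"
  by (simp add: cross_def algebra_simps)

lemma cross_degenerate:
  "cross a b a = 0" "cross a b b = 0"
  by (simp_all add: cross_def algebra_simps)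

text \<open>\<open>cross a b\<close> vanishes on the first segment, whereas on the second it is an
  affine function with end values of equal sign, hence never zero.\<close>

lemma segments_disjoint_if_same_side:
  fixes a b c d :: "real \<times> real"
  assumes "0 < cross a b c * cross a b d"
  shows "closed_segment a b \<inter> closed_segment c d = {}"
proof -
  have "cross a b q = 0" if "q \<in> closed_segment a b" for q
    using that by (auto simp: in_segment cross_affine cross_degenerate)
  moreover have "cross a b q \<noteq> 0" if q: "q \<in> closed_segment c d" for q
  proof -
    obtain t where t: "0 \<le> t" "t \<le> 1" "q = (1 - t) *\<^sub>R c + t *\<^sub>R d"
      using q by (auto simp: in_segment)
    have "0 < (1 - t) * u + t * v" if "0 < u" "0 < v" for u v
      using that t by (metis add.commute add_nonneg_pos add_pos_nonneg diff_ge_0_iff_ge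
          diff_gt_0_iff_gt less_eq_real_def mult_nonneg_nonneg mult_pos_pos zero_less_one)
    from this[of "cross a b c" "cross a b d"] this[of "- cross a b c" "- cross a b d"] assms
    show ?thesis
      by (auto simp: t cross_affine zero_less_mult_iff)
  qed
  ultimately show ?thesis
    by blast
qed

text \<open>At parameter \<open>t\<close> on the segment from \<open>a\<close> to \<open>c\<close>,
  \<open>cross a b\<close> equals \<open>t * cross a b c\<close>, which is zero only at
  \<open>a\<close>.\<close>

lemma segments_meet_only_at_common_end:
  fixes a b c :: "real \<times> real"
  assumes "cross a b c \<noteq> 0"
  shows "closed_segment a b \<inter> closed_segment a c \<subseteq> {a}"
proof
  fix q assume q: "q \<in> closed_segment a b \<inter> closed_segment a c"
  then obtain t where t: "q = (1 - t) *\<^sub>R a + t *\<^sub>R c"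
    by (auto simp: in_segment)
  have "cross a b q = 0"
    using IntD1[OF q] by (auto simp: in_segment cross_affine cross_degenerate)
  then have "t = 0"
    using assms unfolding t cross_affine cross_degenerate by simp
  then show "q \<in> {a}"
    by (simp add: t)
qed

text \<open>The last case needs both disjuncts: of two disjoint segments, possibly only one lies strictly on
  one side of the line through the other.\<close>

fun separated :: "('a \<Rightarrow> int \<times> int) \<Rightarrow> 'a \<times> 'a \<Rightarrow> 'a \<times> 'a \<Rightarrow> bool" where
  "separated p (u, v) (u', v') \<longleftrightarrow>
     (if u = u' then cross (p u) (p v) (p v') \<noteq> 0
      else if v = v' then cross (p v) (p u) (p u') \<noteq> 0
      else if u = v' then cross (p u) (p v) (p u') \<noteq> 0
      else if v = u' then cross (p v) (p u) (p v') \<noteq> 0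
      else 0 < cross (p u) (p v) (p u') * cross (p u) (p v) (p v') \<or>
        0 < cross (p u') (p v') (p u) * cross (p u') (p v') (p v))"

definition grid_point :: "int \<times> int \<Rightarrow> real \<times> real" where
  "grid_point z = (of_int (fst z), of_int (snd z))"

lemma cross_grid_point:
  "cross (grid_point a) (grid_point b) (grid_point c) = of_int (cross a b c)"
  by (simp add: cross_def grid_point_def)

lemma separated_segments:
  assumes "separated p (u, v) (u', v')"
  shows "closed_segment (grid_point (p u)) (grid_point (p v)) \<inter>
      closed_segment (grid_point (p u')) (grid_point (p v'))
    \<subseteq> (grid_point \<circ> p) ` ({u, v} \<inter> {u', v'})"
proof -
  note [simp] = cross_grid_point
  consider "u = u'" "cross (p u) (p v) (p v') \<noteq> 0"
    | "v = v'" "cross (p v) (p u) (p u') \<noteq> 0"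
    | "u = v'" "cross (p u) (p v) (p u') \<noteq> 0"
    | "v = u'" "cross (p v) (p u) (p v') \<noteq> 0"
    | "0 < cross (p u) (p v) (p u') * cross (p u) (p v) (p v')"
    | "0 < cross (p u') (p v') (p u) * cross (p u') (p v') (p v)"
    using assms by (auto split: if_splits)
  then show ?thesis
  proof cases
    case 1
    then show ?thesis
      using segments_meet_only_at_common_end[of "grid_point (p u)" "grid_point (p v)" "grid_point (p v')"]
      by auto
  next
    case 2
    then show ?thesis
      using segments_meet_only_at_common_end[of "grid_point (p v)" "grid_point (p u)" "grid_point (p u')"]
      by (auto simp: closed_segment_commute)
  next
    case 3
    then show ?thesis
      using segments_meet_only_at_common_end[of "grid_point (p u)" "grid_point (p v)" "grid_point (p u')"]
      by (auto simp: closed_segment_commute)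
  next
    case 4
    then show ?thesis
      using segments_meet_only_at_common_end[of "grid_point (p v)" "grid_point (p u)" "grid_point (p v')"]
      by (auto simp: closed_segment_commute)
  next
    case 5
    then have "0 < real_of_int (cross (p u) (p v) (p u') * cross (p u) (p v) (p v'))"
      by (simp only: of_int_0_less_iff)
    then show ?thesis
      by (subst segments_disjoint_if_same_side) auto
  next
    case 6
    then have "0 < real_of_int (cross (p u') (p v') (p u) * cross (p u') (p v') (p v))"
      by (simp only: of_int_0_less_iff)
    then show ?thesis
      by (subst Int_commute, subst segments_disjoint_if_same_side) auto
  qed
qed

text \<open>Reduces upward planarity to integer conditions that can be evaluated: each arc is drawn
  as a straight segment.\<close>

lemma upward_planar_grid_drawing:
  fixes G :: "'a pair_pre_digraph" and p :: "'a \<Rightarrow> int \<times> int"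
  assumes inj: "inj_on p (pverts G)"
    and up: "\<And>u v. (u, v) \<in> parcs G \<Longrightarrow> snd (p u) < snd (p v)"
    and sep: "\<And>e f. \<lbrakk>e \<in> parcs G; f \<in> parcs G; e \<noteq> f\<rbrakk> \<Longrightarrow> separated p e f"
    and cover: "pverts G \<subseteq> Field (parcs G)"
  shows "upward_planar G"
proof -
  define pos where "pos = grid_point \<circ> p"
  define \<gamma> where "\<gamma> = (\<lambda>(u, v). linepath (pos u) (pos v))"
  have injpos: "inj_on pos (pverts G)"
    unfolding pos_def
    by (intro comp_inj_on inj) (auto simp: inj_on_def grid_point_def prod_eq_iff)
  have meet: "path_image (\<gamma> (u, v)) \<inter> path_image (\<gamma> (u', v')) \<subseteq> pos ` ({u, v} \<inter> {u', v'})"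
    if "(u, v) \<in> parcs G" "(u', v') \<in> parcs G" "(u, v) \<noteq> (u', v')" for u v u' v'
    using separated_segments[OF sep[OF that]] by (simp add: \<gamma>_def pos_def)
  have vertex: "path_image (\<gamma> (u, v)) \<inter> pos ` pverts G \<subseteq> {pos u, pos v}"
    if uv: "(u, v) \<in> parcs G" for u v
  proof
    fix z assume "z \<in> path_image (\<gamma> (u, v)) \<inter> pos ` pverts G"
    then obtain w where w: "pos w \<in> path_image (\<gamma> (u, v))" "w \<in> pverts G" "z = pos w"
      by auto
    \<comment> \<open>As every vertex is an end of some arc, a vertex lying on the arc
      \<open>(u, v)\<close> is a point common to two arcs unless both are the same; it is therefore
      an end of \<open>(u, v)\<close>.\<close>
    then obtain u' v' where f: "(u', v') \<in> parcs G" "w = u' \<or> w = v'"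
      using cover by (fastforce simp: Field_def)
    then have "pos w \<in> path_image (\<gamma> (u', v'))"
      by (auto simp: \<gamma>_def)
    with w f meet[OF uv f(1)] show "z \<in> {pos u, pos v}"
      by (cases "(u, v) = (u', v')") auto
  qed
  have rising: "snd (pos u) < snd (pos v)" if "(u, v) \<in> parcs G" for u v
    using up[OF that] by (simp add: pos_def grid_point_def)
  have simple: "simple_path (\<gamma> (u, v))" if "(u, v) \<in> parcs G" for u v
    using rising[OF that] by (auto simp: \<gamma>_def intro: simple_path_linepath)
  have mono: "strict_mono_on {0..1} (\<lambda>t. snd (\<gamma> (u, v) t))" if "(u, v) \<in> parcs G" for u v
  proof (rule strict_mono_onI)
    fix s t :: real assume "s < t"
    then have "0 < (t - s) * (snd (pos v) - snd (pos u))"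
      using rising[OF that] by simp
    then show "snd (\<gamma> (u, v) s) < snd (\<gamma> (u, v) t)"
      by (simp add: \<gamma>_def linepath_def algebra_simps)
  qed
  have "\<forall>(u, v) \<in> parcs G. simple_path (\<gamma> (u, v)) \<and> pathstart (\<gamma> (u, v)) = pos u \<and>
      pathfinish (\<gamma> (u, v)) = pos v \<and> path_image (\<gamma> (u, v)) \<inter> pos ` pverts G \<subseteq> {pos u, pos v}"
  proof (intro ballI case_prodI2)
    fix e u v assume "e \<in> parcs G" "e = (u, v)"
    then have uv: "(u, v) \<in> parcs G"
      by simp
    show "simple_path (\<gamma> (u, v)) \<and> pathstart (\<gamma> (u, v)) = pos u \<and>
        pathfinish (\<gamma> (u, v)) = pos v \<and> path_image (\<gamma> (u, v)) \<inter> pos ` pverts G \<subseteq> {pos u, pos v}"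
      using simple[OF uv] vertex[OF uv] by (simp add: \<gamma>_def)
  qed
  moreover have "\<forall>(u, v) \<in> parcs G. \<forall>(u', v') \<in> parcs G. (u, v) \<noteq> (u', v') \<longrightarrow>
      path_image (\<gamma> (u, v)) \<inter> path_image (\<gamma> (u', v')) \<subseteq> pos ` ({u, v} \<inter> {u', v'})"
    by (intro ballI case_prodI2 impI meet) simp_all
  ultimately have "planar_drawing G pos \<gamma>"
    using injpos by (simp only: planar_drawing_def simp_thms)
  then show ?thesis
    unfolding upward_planar_def using mono by fast
qed

section \<open>The network\<close>

lemma arc_in_undirected_square:
  assumes "(u, v) \<in> parcs G" "u \<in> pverts G" "v \<in> pverts G" "u \<noteq> v"
  shows "(u, v) \<in> parcs (undirected_square G)"
proof -
  have "pre_digraph.apath (with_proj G) u [(u, v)] v"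
    using assms by (simp add: pre_digraph.apath_def pre_digraph.awalk_def cas_with_proj_eq
        awalk_verts_with_proj_eq)
  then show ?thesis
    using assms by (auto simp: undirected_square_def intro!: exI[of _ "[(u, v)]"])
qed

lemma two_path_in_undirected_square:
  assumes "(u, v) \<in> parcs G" "(v, w) \<in> parcs G" "{u, v, w} \<subseteq> pverts G" "distinct [u, v, w]"
  shows "(u, w) \<in> parcs (undirected_square G)"
proof -
  have "pre_digraph.apath (with_proj G) u [(u, v), (v, w)] w"
    using assms by (simp add: pre_digraph.apath_def pre_digraph.awalk_def cas_with_proj_eq
        awalk_verts_with_proj_eq)
  then show ?thesis
    using assms by (auto simp: undirected_square_def intro!: exI[of _ "[(u, v), (v, w)]"])
qed

lemma converse_undirected_square:
  "(parcs (undirected_square G))\<inverse> = parcs (undirected_square G)"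
  by (auto simp: undirected_square_def)

text \<open>Vertices 0 to 9 form the lower outerplanar half and vertices 10 to 19 the upper one; the arcs
  between the two halves start with \<open>(1, 10)\<close>.\<close>

definition net_arcs :: "(nat \<times> nat) list" where
  "net_arcs =
    [(0, 1), (0, 2), (1, 2), (2, 3), (1, 3), (3, 4), (1, 4), (3, 5), (4, 5), (3, 6), (5, 6),
     (6, 7), (5, 7), (7, 8), (5, 8), (8, 9), (5, 9),
     (11, 10), (12, 10), (12, 11), (13, 12), (13, 11), (14, 12), (14, 13), (15, 12), (15, 14),
     (16, 12), (16, 15), (17, 15), (17, 14), (18, 17), (18, 14), (19, 17), (19, 18),
     (1, 10), (1, 12), (4, 12), (5, 12), (9, 12), (8, 12), (7, 12), (7, 16), (7, 15), (7, 17),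
     (7, 19), (6, 19), (6, 18), (3, 18), (2, 18), (2, 14), (2, 13), (2, 11), (0, 11)]"

text \<open>The lower half occupies heights 0 to 10 and the upper half heights 12 to 20, so all arcs
  between the halves rise.\<close>

definition net_pos :: "nat \<Rightarrow> int \<times> int" where
  "net_pos v =
    [(8, 0), (0, 1), (8, 2), (7, 3), (1, 4), (2, 5), (6, 6), (5, 7), (4, 9), (3, 10),
     (-1, 20), (15, 19), (1, 18), (12, 17), (7, 16), (3, 15), (3, 13), (4, 14), (6, 13),
     (5, 12)] ! v"

definition net :: "nat pair_pre_digraph" where
  "net = \<lparr>pverts = {..<20}, parcs = set net_arcs\<rparr>"

section \<open>Finite checks of the network by evaluation\<close>

lemma net_arcs_bounded: "\<forall>(u, v) \<in> set net_arcs. u < 20 \<and> v < 20"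
  by code_simp

lemma net_arcs_rising: "\<forall>(u, v) \<in> set net_arcs. snd (net_pos u) < snd (net_pos v)"
  by code_simp

lemma net_arcs_separated:
  "\<forall>e \<in> set net_arcs. \<forall>f \<in> set net_arcs. e = f \<or> separated net_pos e f"
  by code_simp

lemma net_arcs_cover: "\<forall>v \<in> set [0..<20]. v \<in> fst ` set net_arcs \<union> snd ` set net_arcs"
  by code_simp

lemma net_pos_distinct: "distinct (map net_pos [0..<20])"
  by code_simp

lemma net_degrees:
  "\<forall>v \<in> set [0..<20]. min (length (filter (\<lambda>e. snd e = v) net_arcs))
     (length (filter (\<lambda>e. fst e = v) net_arcs)) \<le> 2"
  by code_simp

lemma upward_planar_net: "upward_planar net"
proof (rule upward_planar_grid_drawing)
  show "inj_on net_pos (pverts net)"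
    using net_pos_distinct by (simp add: net_def distinct_map atLeast0LessThan)
  show "snd (net_pos u) < snd (net_pos v)" if "(u, v) \<in> parcs net" for u v
    using that net_arcs_rising by (auto simp: net_def)
  show "separated net_pos e f" if "e \<in> parcs net" "f \<in> parcs net" "e \<noteq> f" for e f
    using that net_arcs_separated by (auto simp: net_def)
  show "pverts net \<subseteq> Field (parcs net)"
    using net_arcs_cover by (auto simp: net_def Field_def Domain_fst Range_snd)
qed

lemma planar_2_flow_network_net: "planar_2_flow_network net"
proof -
  have "pair_fin_digraph net"
    using net_arcs_bounded by unfold_locales (auto simp: net_def)
  moreover have "min (in_degree (with_proj net) v) (out_degree (with_proj net) v) \<le> 2"
    if "v \<in> pverts net" for v
  proof -
    have "in_arcs (with_proj net) v = set (filter (\<lambda>e. snd e = v) net_arcs)"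
      "out_arcs (with_proj net) v = set (filter (\<lambda>e. fst e = v) net_arcs)"
      by (auto simp: net_def in_arcs_def out_arcs_def)
    \<comment> \<open>List lengths bound the degrees from above, which is the direction required for
      a minimum of at most 2.\<close>
    then have "in_degree (with_proj net) v \<le> length (filter (\<lambda>e. snd e = v) net_arcs)"
      "out_degree (with_proj net) v \<le> length (filter (\<lambda>e. fst e = v) net_arcs)"
      by (simp_all only: in_degree_def out_degree_def card_length)
    moreover have "v \<in> set [0..<20]"
      using that by (simp add: net_def)
    ultimately show ?thesis
      using net_degrees by fastforce
  qed
  ultimately show ?thesis
    using upward_planar_net by (simp add: planar_2_flow_network_def)
qed

section \<open>Counting the edges of the square\<close>

text \<open>Edges of the square, oriented along the directed paths that produce them. Repetitions
  occur when several such paths join the same two vertices.\<close>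

definition net_square_pairs :: "(nat \<times> nat) list" where
  "net_square_pairs =
     net_arcs @ [(fst e, snd f). e \<leftarrow> net_arcs, f \<leftarrow> net_arcs, snd e = fst f]"

lemma length_net_square_pairs: "length (remdups net_square_pairs) = 123"
  by code_simp

text \<open>Heights rise along arcs, so the vertices of a two-step walk are distinct and no listed
  pair occurs reversed. The 123 pairs and their converses thus give 246 different arcs.\<close>

lemma card_arcs_undirected_square_net: "246 \<le> card (parcs (undirected_square net))"
proof -
  let ?D = "set net_square_pairs"
  let ?Q = "parcs (undirected_square net)"
  have rising: "snd (net_pos u) < snd (net_pos v)" if "(u, v) \<in> set net_arcs" for u v
    using that net_arcs_rising by auto
  have bounded: "u < 20 \<and> v < 20" if "(u, v) \<in> set net_arcs" for u v
    using that net_arcs_bounded by auto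
  have D: "(u, w) \<in> set net_arcs \<or> (\<exists>v. (u, v) \<in> set net_arcs \<and> (v, w) \<in> set net_arcs)"
    if "(u, w) \<in> ?D" for u w
    using that by (fastforce simp: net_square_pairs_def)
  have risingD: "snd (net_pos u) < snd (net_pos w)" if "(u, w) \<in> ?D" for u w
    using D[OF that] rising by (meson less_trans)
  have sub: "?D \<subseteq> ?Q"
  proof clarify
    fix u w assume "(u, w) \<in> ?D"
    from D[OF this] show "(u, w) \<in> ?Q"
    proof (elim disjE exE conjE)
      assume "(u, w) \<in> set net_arcs"
      then show ?thesis
        using rising[of u w] bounded[of u w]
        by (intro arc_in_undirected_square) (auto simp: net_def)
    next
      fix v assume "(u, v) \<in> set net_arcs" "(v, w) \<in> set net_arcs"
      then show ?thesis
        using rising[of u v] rising[of v w] bounded[of u v] bounded[of v w]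
        by (intro two_path_in_undirected_square[of u v]) (auto simp: net_def)
    qed
  qed
  have "?D \<inter> ?D\<inverse> = {}"
  proof (intro equals0I, elim IntE converseE, clarify)
    fix u w assume "(u, w) \<in> ?D" "(w, u) \<in> ?D"
    from risingD[OF this(1)] risingD[OF this(2)] show False
      by simp
  qed
  then have "card (?D \<union> ?D\<inverse>) = card ?D + card ?D"
    by (subst card_Un_disjoint) auto
  moreover have "card ?D = 123"
    using length_net_square_pairs by (simp only: List.card_set)
  moreover have "?D \<union> ?D\<inverse> \<subseteq> ?Q"
    using sub converse_undirected_square[of net] by blast
  moreover have "finite ?Q"
    by (rule finite_subset[of _ "{..<20} \<times> {..<20}"]) (auto simp: undirected_square_def net_def)
  ultimately show ?thesis
    using card_mono[of ?Q "?D \<union> ?D\<inverse>"] by simp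
qed

theorem theorem4:
  shows "\<exists>G :: nat pair_pre_digraph.
    planar_2_flow_network G \<and> \<not> weak_bar_1_visibility_graph (undirected_square G)"
proof (intro exI conjI notI)
  show "planar_2_flow_network net"
    by (rule planar_2_flow_network_net)
  assume "weak_bar_1_visibility_graph (undirected_square net)"
  \<comment> \<open>The bound for 20 vertices is 12 * 20 = 240 arcs, fewer than 246.\<close>
  from weak_bar_1_visibility_graph_card[OF this] card_arcs_undirected_square_net show False
    by (simp add: undirected_square_def net_def)
qed

end
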